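(* Let $(S,\cdot,\leq)$ be an ordered semigroup and let $m\geq 1$ be an integer. Then the following statements hold: (1) Every $m$-left ideal of $S$ and every $m$-right ideal of $S$ is an $m$-bi-interior ideal of $S$. (2) Every $m$-ideal of $S$ is an $m$-bi-interior ideal of $S$. (3) If $A$ and $B$ are $m$-bi-interior ideals of $S$, then $A\cap B$ (provided the intersection is non-empty) is an $m$-bi-interior ideal of $S$. (4) The intersection of an $m$-right ideal of $S$ and an $m$-left ideal of $S$ is an $m$-bi-interior ideal of $S$. (5) Every $m$-quasi-ideal of $S$ is an $m$-bi-interior ideal of $S$. (6) Every $m$-bi-ideal of $S$ is an $m$-bi-interior ideal of $S$. (7) Every $m$-interior ideal of $S$ is an $m$-bi-interior ideal of $S$. (8) If $B$ is an $m$-bi-interior ideal of $S$, then $(BS]$ and $(SB]$ are $m$-bi-interior ideals of $S$. (9) If $T$ is an $m$-right ideal of $S$ and $B$ is an $m$-bi-interior ideal of $S$, then $B\cap T$ is an $m$-bi-interior ideal of $S$.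
   Context: An ordered semigroup $(S,\cdot,\leq)$ is a semigroup with a partial order such that $a\leq b$ implies $xa\leq xb$ and $ax\leq bx$ for all $a,b,x\in S$. For $A,B\subseteq S$, $AB=\{ab: a\in A, b\in B\}$, and $S^m=S\cdots S$ ($m$ factors) is the set of all products of $m$ elements of $S$. For $H\subseteq S$, $(H]=\{t\in S: t\leq h \text{ for some } h\in H\}$. Subsemigroups are understood to be non-empty. Let $m\geq 1$ be an integer. - An $m$-left ideal of $S$ is a subsemigroup $L$ of $S$ with $S^mL\subseteq L$ and $(L]=L$; an $m$-right ideal is a subsemigroup $R$ with $RS^m\subseteq R$ and $(R]=R$; an $m$-ideal is a subsemigroup that is both an $m$-left and an $m$-right ideal. - An $m$-bi-ideal is a subsemigroup $B$ with $BS^mB\subseteq B$ and $(B]=B$. - An $m$-interior ideal is a subsemigroup $I$ with $S^mIS^m\subseteq I$ and $(I]=I$. - An $m$-quasi-ideal is a subsemigroup $Q$ with $(S^mQ]\cap(QS^m]\subseteq Q$ and $(Q]=Q$. - An $m$-bi-interior ideal is a non-empty subset $B$ of $S$ (not required to be a subsemigroup) with $(BS^mB]\cap(S^mBS^m]\subseteq B$ and $(B]=B$.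
   Formalization: In (9) the intersection of B and T is additionally assumed non-empty, as in (3); without this (9) fails, e.g. for T={a}, B={b} in the two-element left zero semigroup (xy=x) with the discrete order. *)

theory Defs
  imports Main "HOL-Library.Set_Algebras"
begin

text \<open>
  The ordered semigroup \<open>S\<close> is the whole type, so the set \<open>S\<close> is \<^term>\<open>UNIV\<close>.
  For sets, \<open>A * B\<close> is the elementwise product from \<^theory>\<open>HOL-Library.Set_Algebras\<close>.
\<close>

class ordered_semigroup = semigroup_mult + order +
  assumes le_mult_left: "a \<le> b \<Longrightarrow> x * a \<le> x * b"
    and le_mult_right: "a \<le> b \<Longrightarrow> a * x \<le> b * x"

text \<open>
  There is no unit, so the \<open>power\<close> class does not apply to sets of semigroup elements.
  \<open>set_pow A m\<close> is the product of \<open>m\<close> copies of \<open>A\<close>; it is meaningful only for \<open>m \<ge> 1\<close>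
  (at \<open>m = 0\<close> truncated subtraction makes it \<open>A\<close>).
\<close>

definition set_pow :: "'a::semigroup_mult set \<Rightarrow> nat \<Rightarrow> 'a set" where
  "set_pow A m = (((*) A) ^^ (m - 1)) A"

abbreviation S_pow :: "nat \<Rightarrow> 'a::semigroup_mult set" where
  "S_pow m \<equiv> set_pow UNIV m"

text \<open>The downward closure, written \<open>(H]\<close> in the literature.\<close>

definition down :: "'a::order set \<Rightarrow> 'a set" where
  "down H = {t. \<exists>h\<in>H. t \<le> h}"

definition subsemigroup :: "'a::semigroup_mult set \<Rightarrow> bool" where
  "subsemigroup A \<longleftrightarrow> A \<noteq> {} \<and> A * A \<subseteq> A"

definition m_left_ideal :: "nat \<Rightarrow> 'a::ordered_semigroup set \<Rightarrow> bool" where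
  "m_left_ideal m L \<longleftrightarrow> subsemigroup L \<and> S_pow m * L \<subseteq> L \<and> down L = L"

definition m_right_ideal :: "nat \<Rightarrow> 'a::ordered_semigroup set \<Rightarrow> bool" where
  "m_right_ideal m R \<longleftrightarrow> subsemigroup R \<and> R * S_pow m \<subseteq> R \<and> down R = R"

definition m_ideal :: "nat \<Rightarrow> 'a::ordered_semigroup set \<Rightarrow> bool" where
  "m_ideal m I \<longleftrightarrow> m_left_ideal m I \<and> m_right_ideal m I"

definition m_bi_ideal :: "nat \<Rightarrow> 'a::ordered_semigroup set \<Rightarrow> bool" where
  "m_bi_ideal m B \<longleftrightarrow> subsemigroup B \<and> B * S_pow m * B \<subseteq> B \<and> down B = B"

definition m_interior_ideal :: "nat \<Rightarrow> 'a::ordered_semigroup set \<Rightarrow> bool" where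
  "m_interior_ideal m I \<longleftrightarrow> subsemigroup I \<and> S_pow m * I * S_pow m \<subseteq> I \<and> down I = I"

definition m_quasi_ideal :: "nat \<Rightarrow> 'a::ordered_semigroup set \<Rightarrow> bool" where
  "m_quasi_ideal m Q \<longleftrightarrow>
     subsemigroup Q \<and> down (S_pow m * Q) \<inter> down (Q * S_pow m) \<subseteq> Q \<and> down Q = Q"

text \<open>Unlike the notions above, this one asks only for a non-empty set, not a subsemigroup.\<close>

definition m_bi_interior_ideal :: "nat \<Rightarrow> 'a::ordered_semigroup set \<Rightarrow> bool" where
  "m_bi_interior_ideal m B \<longleftrightarrow>
     B \<noteq> {} \<and> down (B * S_pow m * B) \<inter> down (S_pow m * B * S_pow m) \<subseteq> B \<and> down B = B"

end

theory Submission
  imports Defs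
begin

text \<open>
  A down-closed non-empty set is an \<open>m\<close>-bi-interior ideal as soon as one of the two products
  \<open>B S\<^sup>m B\<close> and \<open>S\<^sup>m B S\<^sup>m\<close> lies in it. Items (1), (2), (6), (7), (8) come down to one of these
  inclusions, and (4), (9) then follow from (3); for (5) both \<open>S\<^sup>m Q\<close> and \<open>Q S\<^sup>m\<close> contain \<open>Q S\<^sup>m Q\<close>, because \<open>S\<^sup>m\<close> is a two-sided ideal.
\<close>

lemma down_mono: "A \<subseteq> B \<Longrightarrow> down A \<subseteq> down B"
  unfolding down_def by blast

lemma down_down [simp]: "down (down A) = down A"
  unfolding down_def by (blast intro: order_trans)

lemma subset_down: "A \<subseteq> down A"
  unfolding down_def by blast

lemma down_Int_closed:
  assumes "down A = A" "down B = B"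
  shows "down (A \<inter> B) = A \<inter> B"
  using assms down_mono[of "A \<inter> B" A] down_mono[of "A \<inter> B" B] subset_down[of "A \<inter> B"]
  by blast

text \<open>Compatibility of the order with multiplication moves the closure outside a product; with
  \<open>down_mult_left\<close> this is what item (8) needs.\<close>

lemma down_mult_right: "down A * B \<subseteq> down (A * (B :: 'a::ordered_semigroup set))"
  by (auto simp: down_def set_times_def intro: le_mult_right)

lemma down_mult_left: "A * down B \<subseteq> down (A * (B :: 'a::ordered_semigroup set))"
  by (auto simp: down_def set_times_def intro: le_mult_left)

lemma set_times_nonempty: "A \<noteq> {} \<Longrightarrow> B \<noteq> {} \<Longrightarrow> A * B \<noteq> {}"
  by (auto simp: set_times_def)

lemma set_pow_mono: "A \<subseteq> B \<Longrightarrow> set_pow A m \<subseteq> set_pow B m"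
proof -
  assume "A \<subseteq> B"
  \<comment> \<open>The induction runs over the iteration count \<open>n\<close>, later instantiated
    by \<open>m - 1\<close>, so truncated subtraction never enters it.\<close>
  then have "(((*) A) ^^ n) A \<subseteq> (((*) B) ^^ n) B" for n
    by (induction n) (simp_all add: set_times_mono2)
  then show ?thesis unfolding set_pow_def .
qed

lemma set_pow_nonempty: "A \<noteq> {} \<Longrightarrow> set_pow A m \<noteq> {}"
proof -
  assume "A \<noteq> {}"
  then have "(((*) A) ^^ n) A \<noteq> {}" for n
    by (induction n) (simp_all add: set_times_nonempty)
  then show ?thesis unfolding set_pow_def .
qed

lemma subsemigroup_set_pow: "subsemigroup A \<Longrightarrow> set_pow A m \<subseteq> A"
proof -
  assume A: "subsemigroup A"
  have "(((*) A) ^^ n) A \<subseteq> A" for n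
  proof (induction n)
    case (Suc n)
    have "A * (((*) A) ^^ n) A \<subseteq> A * A"
      using Suc by (intro set_times_mono2) auto
    then show ?case using A by (auto simp: subsemigroup_def)
  qed simp
  then show ?thesis unfolding set_pow_def .
qed

text \<open>The outermost factor \<open>UNIV\<close> absorbs \<open>A\<close> after reassociation;
  the induction is merely a case split exposing that factor.\<close>

lemma mult_S_pow: "A * S_pow m \<subseteq> S_pow m"
proof -
  have "A * (((*) UNIV) ^^ n) UNIV \<subseteq> (((*) UNIV) ^^ n) UNIV" for n
  proof (induction n)
    case (Suc n)
    have "(A * UNIV) * (((*) UNIV) ^^ n) UNIV \<subseteq> UNIV * (((*) UNIV) ^^ n) UNIV"
      by (intro set_times_mono2) auto
    then show ?case by (simp add: mult.assoc)
  qed simp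
  then show ?thesis unfolding set_pow_def .
qed

text \<open>Powers grow on the left, so the last factor is innermost: here the induction carries
  \<open>A\<close> inwards until it meets that \<open>UNIV\<close>.\<close>

lemma S_pow_mult: "S_pow m * A \<subseteq> S_pow m"
proof -
  have "(((*) UNIV) ^^ n) UNIV * A \<subseteq> (((*) UNIV) ^^ n) UNIV" for n
  proof (induction n)
    case (Suc n)
    then have "UNIV * ((((*) UNIV) ^^ n) UNIV * A) \<subseteq> UNIV * (((*) UNIV) ^^ n) UNIV"
      by (intro set_times_mono2) auto
    then show ?case by (simp add: mult.assoc)
  qed simp
  then show ?thesis unfolding set_pow_def .
qed

text \<open>If one product lies in \<open>B\<close>, its closure lies in \<open>down B = B\<close>,
  and hence so does the intersection of both closures.\<close>

lemma m_bi_interior_idealI: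
  assumes "B \<noteq> {}" "down B = B" "B * S_pow m * B \<subseteq> B \<or> S_pow m * B * S_pow m \<subseteq> B"
  shows "m_bi_interior_ideal m B"
  using assms down_mono[of "B * S_pow m * B" B] down_mono[of "S_pow m * B * S_pow m" B]
  unfolding m_bi_interior_ideal_def by blast

lemma m_bi_ideal_bi_interior: "m_bi_ideal m B \<Longrightarrow> m_bi_interior_ideal m B"
  unfolding m_bi_ideal_def subsemigroup_def by (blast intro: m_bi_interior_idealI)

lemma m_interior_ideal_bi_interior: "m_interior_ideal m I \<Longrightarrow> m_bi_interior_ideal m I"
  unfolding m_interior_ideal_def subsemigroup_def by (blast intro: m_bi_interior_idealI)

text \<open>First \<open>S_pow m * L\<close> falls into \<open>L\<close>, then the subsemigroup
  property absorbs \<open>A\<close>. With \<open>A = L\<close> this is the bi-ideal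
  inclusion.\<close>

lemma m_left_ideal_absorbs:
  assumes "m_left_ideal m L" "A \<subseteq> L"
  shows "A * S_pow m * L \<subseteq> L"
proof -
  have "A * S_pow m * L \<subseteq> L * L"
    using assms set_times_mono2[of A L "S_pow m * L" L]
    by (simp add: m_left_ideal_def mult.assoc)
  then show ?thesis using assms by (auto simp: m_left_ideal_def subsemigroup_def)
qed

lemma m_right_ideal_absorbs:
  assumes "m_right_ideal m R" "A \<subseteq> R"
  shows "R * S_pow m * A \<subseteq> R"
proof -
  have "R * S_pow m * A \<subseteq> R * R"
    using assms set_times_mono2[of "R * S_pow m" R A R] by (simp add: m_right_ideal_def)
  then show ?thesis using assms by (auto simp: m_right_ideal_def subsemigroup_def)
qed

lemma m_left_ideal_bi_interior: "m_left_ideal m L \<Longrightarrow> m_bi_interior_ideal m L"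
  using m_left_ideal_absorbs[of m L L]
  by (auto simp: m_left_ideal_def subsemigroup_def intro!: m_bi_interior_idealI)

lemma m_right_ideal_bi_interior: "m_right_ideal m R \<Longrightarrow> m_bi_interior_ideal m R"
  using m_right_ideal_absorbs[of m R R]
  by (auto simp: m_right_ideal_def subsemigroup_def intro!: m_bi_interior_idealI)

lemma m_bi_interior_ideal_Int:
  assumes A: "m_bi_interior_ideal m A" and B: "m_bi_interior_ideal m B" and "A \<inter> B \<noteq> {}"
  shows "m_bi_interior_ideal m (A \<inter> B)"
proof -
  \<comment> \<open>Both products are monotone in the ideal, so one argument serves
    \<open>C = A\<close> and \<open>C = B\<close>.\<close>
  have "down ((A \<inter> B) * S_pow m * (A \<inter> B)) \<inter> down (S_pow m * (A \<inter> B) * S_pow m) \<subseteq> C"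
    if "m_bi_interior_ideal m C" "A \<inter> B \<subseteq> C" for C
  proof -
    have "down ((A \<inter> B) * S_pow m * (A \<inter> B)) \<subseteq> down (C * S_pow m * C)"
      "down (S_pow m * (A \<inter> B) * S_pow m) \<subseteq> down (S_pow m * C * S_pow m)"
      using that(2) by (intro down_mono set_times_mono2 order_refl; assumption)+
    then show ?thesis using that(1) unfolding m_bi_interior_ideal_def by blast
  qed
  from this[OF A] this[OF B] show ?thesis
    using assms down_Int_closed[of A B] unfolding m_bi_interior_ideal_def by simp
qed

text \<open>\<open>R\<^sup>m L\<^sup>m\<close> witnesses that the intersection is non-empty.\<close>
lemma m_right_Int_left_nonempty:
  assumes R: "m_right_ideal m R" and L: "m_left_ideal m L"
  shows "R \<inter> L \<noteq> {}"
proof -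
  have sub: "subsemigroup R" "subsemigroup L"
    using R L by (auto simp: m_right_ideal_def m_left_ideal_def)
  \<comment> \<open>In the first inclusion the left factor shrinks into \<open>R\<close> and the
    right one is enlarged to \<open>S_pow m\<close>; in the second the roles are exchanged.\<close>
  have "set_pow R m * set_pow L m \<subseteq> R * S_pow m" "set_pow R m * set_pow L m \<subseteq> S_pow m * L"
    using sub by (simp_all add: set_times_mono2 subsemigroup_set_pow set_pow_mono)
  moreover have "set_pow R m * set_pow L m \<noteq> {}"
    using sub by (intro set_times_nonempty set_pow_nonempty) (auto simp: subsemigroup_def)
  ultimately show ?thesis
    using R L unfolding m_right_ideal_def m_left_ideal_def by blast
qed

lemma m_quasi_ideal_bi_interior:
  assumes "m_quasi_ideal m Q"
  shows "m_bi_interior_ideal m Q"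
proof (rule m_bi_interior_idealI)
  \<comment> \<open>The two bounds come from the two bracketings: \<open>S_pow m\<close> swallows
    the left \<open>Q\<close> here and the right \<open>Q\<close> below.\<close>
  have "Q * S_pow m * Q \<subseteq> S_pow m * Q"
    by (intro set_times_mono2 mult_S_pow order_refl)
  moreover have "Q * S_pow m * Q \<subseteq> Q * S_pow m"
    unfolding mult.assoc by (intro set_times_mono2 S_pow_mult order_refl)
  ultimately show "Q * S_pow m * Q \<subseteq> Q \<or> S_pow m * Q * S_pow m \<subseteq> Q"
    using assms subset_down[of "S_pow m * Q"] subset_down[of "Q * S_pow m"]
    unfolding m_quasi_ideal_def by blast
qed (use assms in \<open>auto simp: m_quasi_ideal_def subsemigroup_def\<close>)

lemma m_bi_interior_ideal_down_right:
  assumes "B \<noteq> {}"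
  shows "m_bi_interior_ideal m (down (B * UNIV))"
proof (rule m_bi_interior_idealI)
  \<comment> \<open>\<open>(BS]\<close> is a right ideal, since \<open>UNIV * C\<close> lies in
    \<open>UNIV\<close>. Taking \<open>C = S_pow m * down (B * UNIV)\<close> gives the first
    disjunct.\<close>
  have "down (B * UNIV) * C \<subseteq> down (B * UNIV)" for C
    using down_mult_right[of "B * UNIV" C] down_mono[of "B * (UNIV * C)" "B * UNIV"]
      set_times_mono2[of B B "UNIV * C" UNIV] by (simp add: mult.assoc)
  then show "down (B * UNIV) * S_pow m * down (B * UNIV) \<subseteq> down (B * UNIV)
      \<or> S_pow m * down (B * UNIV) * S_pow m \<subseteq> down (B * UNIV)"
    by (simp add: mult.assoc)
  show "down (B * UNIV) \<noteq> {}"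
    using set_times_nonempty[OF assms UNIV_not_empty] subset_down[of "B * UNIV"] by blast
qed simp

lemma m_bi_interior_ideal_down_left:
  assumes "B \<noteq> {}"
  shows "m_bi_interior_ideal m (down (UNIV * B))"
proof (rule m_bi_interior_idealI)
  \<comment> \<open>Dually \<open>(SB]\<close> is a left ideal; now
    \<open>C = down (UNIV * B) * S_pow m\<close>.\<close>
  have "C * down (UNIV * B) \<subseteq> down (UNIV * B)" for C
    using down_mult_left[of C "UNIV * B"] down_mono[of "C * UNIV * B" "UNIV * B"]
      set_times_mono2[of "C * UNIV" UNIV B B] by (simp add: mult.assoc)
  then show "down (UNIV * B) * S_pow m * down (UNIV * B) \<subseteq> down (UNIV * B)
      \<or> S_pow m * down (UNIV * B) * S_pow m \<subseteq> down (UNIV * B)"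
    by simp
  show "down (UNIV * B) \<noteq> {}"
    using set_times_nonempty[OF UNIV_not_empty assms] subset_down[of "UNIV * B"] by blast
qed simp

theorem proposition2p3:
  fixes m :: nat
  assumes "m \<ge> 1"
  shows
    "(\<forall>L :: 'a::ordered_semigroup set. m_left_ideal m L \<longrightarrow> m_bi_interior_ideal m L)
   \<and> (\<forall>R :: 'a set. m_right_ideal m R \<longrightarrow> m_bi_interior_ideal m R)
   \<and> (\<forall>I :: 'a set. m_ideal m I \<longrightarrow> m_bi_interior_ideal m I)
   \<and> (\<forall>A B :: 'a set. m_bi_interior_ideal m A \<longrightarrow> m_bi_interior_ideal m B \<longrightarrow>
        A \<inter> B \<noteq> {} \<longrightarrow> m_bi_interior_ideal m (A \<inter> B))
   \<and> (\<forall>R L :: 'a set. m_right_ideal m R \<longrightarrow> m_left_ideal m L \<longrightarrow>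
        m_bi_interior_ideal m (R \<inter> L))
   \<and> (\<forall>Q :: 'a set. m_quasi_ideal m Q \<longrightarrow> m_bi_interior_ideal m Q)
   \<and> (\<forall>B :: 'a set. m_bi_ideal m B \<longrightarrow> m_bi_interior_ideal m B)
   \<and> (\<forall>I :: 'a set. m_interior_ideal m I \<longrightarrow> m_bi_interior_ideal m I)
   \<and> (\<forall>B :: 'a set. m_bi_interior_ideal m B \<longrightarrow>
        m_bi_interior_ideal m (down (B * UNIV)) \<and> m_bi_interior_ideal m (down (UNIV * B)))
   \<and> (\<forall>T B :: 'a set. m_right_ideal m T \<longrightarrow> m_bi_interior_ideal m B \<longrightarrow>
        B \<inter> T \<noteq> {} \<longrightarrow> m_bi_interior_ideal m (B \<inter> T))"
proof (intro conjI allI impI)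
  fix R L :: "'a set"
  assume "m_right_ideal m R" "m_left_ideal m L"
  then show "m_bi_interior_ideal m (R \<inter> L)"
    by (intro m_bi_interior_ideal_Int m_right_ideal_bi_interior m_left_ideal_bi_interior
        m_right_Int_left_nonempty)
next
  fix B :: "'a set"
  assume "m_bi_interior_ideal m B"
  then have "B \<noteq> {}" by (simp add: m_bi_interior_ideal_def)
  then show "m_bi_interior_ideal m (down (B * UNIV))" "m_bi_interior_ideal m (down (UNIV * B))"
    by (simp_all add: m_bi_interior_ideal_down_right m_bi_interior_ideal_down_left)
\<comment> \<open>Item (2) follows from either half of \<open>m_ideal\<close>; for (9),
  \<open>T\<close> is itself bi-interior by (1), so (3) applies.\<close>
qed (simp_all add: m_ideal_def m_left_ideal_bi_interior m_right_ideal_bi_interior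
      m_bi_interior_ideal_Int m_quasi_ideal_bi_interior m_bi_ideal_bi_interior
      m_interior_ideal_bi_interior)

end
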